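(* Let $(X_i)_{i<\omega}$ be an increasing sequence of countable sets, and for each $i<\omega$ let $<^i$ be a linear order on $X_i$ of order type $\omega$, such that $<^{i+1}|_{X_i}$ almost agrees with $<^i$ for all $i<\omega$. Then there are linear orders $\lessdot^i$ on $X_i$ of order type $\omega$ such that $\lessdot^0=<^0$, and for all $i<\omega$, $\lessdot^i$ almost agrees with $<^i$ and $\lessdot^{i+1}|_{X_i}=\lessdot^i$.
   Context: Two linear orders $<^1,<^2$ on a set $Z$ almost agree if there is a finite $Z_0\subseteq Z$ such that $<^1$ and $<^2$ coincide on $Z\setminus Z_0$. For $X\subseteq Y$ and an order $<$ on $Y$, $<|_X$ denotes its restriction to $X$. *)

theory Defs
  imports Main "HOL-Library.Countable_Set"
begin

text \<open>
  Linear orders are strict, following the notation \<open><\<close>. The library predicate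
  \<^const>\<open>strict_linear_order_on\<close> does not confine the relation to the carrier; the extra
  conjunct does, so that equality of relations is equality of orders.
\<close>

definition linear_order_of :: "'a set \<Rightarrow> 'a rel \<Rightarrow> bool" where
  "linear_order_of Z r \<longleftrightarrow> r \<subseteq> Z \<times> Z \<and> strict_linear_order_on Z r"

definition order_type_omega :: "'a set \<Rightarrow> 'a rel \<Rightarrow> bool" where
  "order_type_omega Z r \<longleftrightarrow>
     (\<exists>f :: nat \<Rightarrow> 'a. bij_betw f UNIV Z \<and> (\<forall>m n. (f m, f n) \<in> r \<longleftrightarrow> m < n))"

definition almost_agree :: "'a set \<Rightarrow> 'a rel \<Rightarrow> 'a rel \<Rightarrow> bool" where
  "almost_agree Z r s \<longleftrightarrow>
     (\<exists>Z\<^sub>0 \<subseteq> Z. finite Z\<^sub>0 \<and> Restr r (Z - Z\<^sub>0) = Restr s (Z - Z\<^sub>0))"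

end

theory Submission
  imports Defs
begin

text \<open>
  Extend one step at a time. If an order \<open>S\<close> on \<open>X\<close> agrees with an order \<open>R\<close> on \<open>Y \<supseteq> X\<close> outside
  a finite subset of \<open>X\<close>, enlarge that subset to a finite initial segment \<open>D\<close> of \<open>S\<close>. Putting \<open>D\<close>
  first, ordered by \<open>S\<close>, and then \<open>Y - D\<close>, ordered by \<open>R\<close>, gives an order on \<open>Y\<close> that extends \<open>S\<close>
  because \<open>D\<close> is an initial segment, and that differs from \<open>R\<close> only on the finite set \<open>D\<close>.
\<close>

text \<open>Counting predecessors embeds such an order into the natural numbers, and an infinite set
  of naturals has order type omega. In this form, order type omega can be checked for a newly built
  order without exhibiting an enumeration.\<close>

lemma order_type_omega_iff:
  assumes lin: "linear_order_of Z r"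
  shows "order_type_omega Z r \<longleftrightarrow> infinite Z \<and> (\<forall>y\<in>Z. finite {x. (x, y) \<in> r})"
proof
  assume "order_type_omega Z r"
  then obtain f :: "nat \<Rightarrow> 'a" where f: "bij_betw f UNIV Z" "\<And>m n. (f m, f n) \<in> r \<longleftrightarrow> m < n"
    unfolding order_type_omega_def by blast
  have "infinite Z" using f(1) bij_betw_finite by blast
  moreover have "finite {x. (x, y) \<in> r}" if y: "y \<in> Z" for y
  proof -
    obtain n where n: "y = f n" using y f(1) unfolding bij_betw_def by blast
    have "{x. (x, y) \<in> r} \<subseteq> f ` {..<n}"
    proof
      fix x assume x: "x \<in> {x. (x, y) \<in> r}"
      then have "x \<in> Z" using lin unfolding linear_order_of_def by blast
      then obtain m where "x = f m" using f(1) unfolding bij_betw_def by blast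
      with x n f(2) show "x \<in> f ` {..<n}" by auto
    qed
    then show ?thesis by (rule finite_subset) simp
  qed
  ultimately show "infinite Z \<and> (\<forall>y\<in>Z. finite {x. (x, y) \<in> r})" by blast
next
  assume asm: "infinite Z \<and> (\<forall>y\<in>Z. finite {x. (x, y) \<in> r})"
  define rank where "rank y = card {x. (x, y) \<in> r}" for y
  have tr: "trans r" and irr: "irrefl r" and tot: "total_on Z r" and sub: "r \<subseteq> Z \<times> Z"
    using lin unfolding linear_order_of_def strict_linear_order_on_def by auto
  have rank_less: "rank x < rank y" if "(x, y) \<in> r" for x y
    unfolding rank_def
  proof (rule psubset_card_mono)
    show "finite {u. (u, y) \<in> r}" using asm that sub by blast
    \<comment> \<open>Inclusion is transitivity; it is strict because \<open>x\<close> precedes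
      \<open>y\<close> but not itself.\<close>
    show "{u. (u, x) \<in> r} \<subset> {u. (u, y) \<in> r}"
      using that tr irr unfolding irrefl_def by (blast dest: transD)
  qed
  have rank_iff: "(x, y) \<in> r \<longleftrightarrow> rank x < rank y" if "x \<in> Z" "y \<in> Z" for x y
    using that rank_less tot unfolding total_on_def by (metis less_asym less_irrefl)
  have inj: "inj_on rank Z"
    using rank_iff tot unfolding inj_on_def total_on_def by (metis less_irrefl)
  have inf: "infinite (rank ` Z)" using asm inj finite_image_iff by blast
  \<comment> \<open>\<open>enumerate\<close> lists the infinite set of ranks in increasing order,
    and inverting \<open>rank\<close> carries this list back to \<open>Z\<close>.\<close>
  define f where "f = inv_into Z rank \<circ> enumerate (rank ` Z)"
  have "bij_betw f UNIV Z"
    unfolding f_def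
    by (rule bij_betw_trans[OF bij_enumerate[OF inf]])
      (simp add: bij_betw_inv_into inj inj_on_imp_bij_betw)
  moreover have "(f m, f n) \<in> r \<longleftrightarrow> m < n" for m n
  proof -
    have e: "enumerate (rank ` Z) k \<in> rank ` Z" for k by (rule enumerate_in_set[OF inf])
    have fk: "f k \<in> Z" "rank (f k) = enumerate (rank ` Z) k" for k
      using inv_into_into[OF e] f_inv_into_f[OF e] by (simp_all add: f_def)
    show ?thesis using rank_iff[OF fk(1) fk(1)] by (simp add: fk(2) enumerate_mono_iff inf)
  qed
  ultimately show "order_type_omega Z r" unfolding order_type_omega_def by blast
qed

lemma almost_agree_refl: "almost_agree Z r r"
  unfolding almost_agree_def by blast

lemma almost_agree_sym: "almost_agree Z r s \<Longrightarrow> almost_agree Z s r"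
  unfolding almost_agree_def by metis

lemma almost_agree_trans:
  assumes "almost_agree Z r s" "almost_agree Z s t"
  shows "almost_agree Z r t"
proof -
  obtain A B where A: "A \<subseteq> Z" "finite A" "Restr r (Z - A) = Restr s (Z - A)"
    and B: "B \<subseteq> Z" "finite B" "Restr s (Z - B) = Restr t (Z - B)"
    using assms unfolding almost_agree_def by blast
  have "Restr r (Z - (A \<union> B)) = Restr t (Z - (A \<union> B))" using A(3) B(3) by blast
  with A B show ?thesis unfolding almost_agree_def by (intro exI[of _ "A \<union> B"]) simp
qed

lemma extend_order_type_omega:
  assumes XY: "X \<subseteq> Y"
    and linS: "linear_order_of X S" and omS: "order_type_omega X S"
    and linR: "linear_order_of Y R" and omR: "order_type_omega Y R"
    and agree: "almost_agree X (Restr R X) S"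
  shows "\<exists>T. linear_order_of Y T \<and> order_type_omega Y T \<and> almost_agree Y T R \<and> Restr T X = S"
proof -
  obtain A where A: "A \<subseteq> X" "finite A" "Restr (Restr R X) (X - A) = Restr S (X - A)"
    using agree unfolding almost_agree_def by blast
  \<comment> \<open>The downward closure of the exceptional set \<open>A\<close> under
    \<open>S\<close>: finite because each point has finitely many
    \<open>S\<close>-predecessors.\<close>
  define D where "D = A \<union> {x. \<exists>a\<in>A. (x, a) \<in> S}"
  define T where "T = Restr S D \<union> D \<times> (Y - D) \<union> Restr R (Y - D)"
  have S: "S \<subseteq> X \<times> X" "trans S" "irrefl S" "total_on X S"
    and R: "R \<subseteq> Y \<times> Y" "trans R" "irrefl R" "total_on Y R"
    using linS linR unfolding linear_order_of_def strict_linear_order_on_def by auto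
  have predS: "finite {x. (x, y) \<in> S}" if "y \<in> X" for y
    using omS that by (simp add: order_type_omega_iff[OF linS])
  have infY: "infinite Y" and predR: "\<And>y. y \<in> Y \<Longrightarrow> finite {x. (x, y) \<in> R}"
    using omR by (simp_all add: order_type_omega_iff[OF linR])
  have DX: "D \<subseteq> X" using A(1) S(1) unfolding D_def by blast
  have "D = A \<union> (\<Union>a\<in>A. {x. (x, a) \<in> S})" unfolding D_def by blast
  then have finD: "finite D" using A(1,2) predS by auto
  have initial: "x \<in> D" if "(x, y) \<in> S" "y \<in> D" for x y
    using that S(2) unfolding D_def by (blast dest: transD)
  have outside: "(x, y) \<in> R \<longleftrightarrow> (x, y) \<in> S" if "x \<in> X - D" "y \<in> X - D" for x y
    using that A(3) unfolding D_def by blast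
  have "trans T"
    using S(2) R(2) unfolding T_def by (intro transI) (blast dest: transD)
  moreover have "irrefl T"
    using S(3) R(3) unfolding T_def irrefl_def by blast
  moreover have "total_on Y T"
    using S(4) R(4) DX unfolding T_def total_on_def by blast
  moreover have "T \<subseteq> Y \<times> Y"
    using DX XY unfolding T_def by blast
  ultimately have linT: "linear_order_of Y T"
    unfolding linear_order_of_def strict_linear_order_on_def by blast
  \<comment> \<open>Below a point of \<open>D\<close> there are only points of \<open>D\<close>;
    below any other point there are the points of \<open>D\<close> and some of its
    \<open>R\<close>-predecessors.\<close>
  have "finite {x. (x, y) \<in> T}" if "y \<in> Y" for y
    by (rule finite_subset[of _ "D \<union> {x. (x, y) \<in> R}"])
      (use finD predR[OF that] in \<open>auto simp: T_def\<close>)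
  then have "order_type_omega Y T"
    using infY by (simp add: order_type_omega_iff[OF linT])
  moreover have "Restr T (Y - D) = Restr R (Y - D)" unfolding T_def by blast
  then have "almost_agree Y T R"
    using finD DX XY unfolding almost_agree_def by (intro exI[of _ D]) auto
  moreover have "(x, y) \<in> Restr T X \<longleftrightarrow> (x, y) \<in> S" for x y
  proof (cases "x \<in> X \<and> y \<in> X")
    case True
    \<comment> \<open>\<open>T\<close> puts \<open>x\<close> before \<open>y\<close> here. So does
      \<open>S\<close>: by totality the alternative is that \<open>y\<close> precedes
      \<open>x\<close>, which would put \<open>y\<close> into the initial segment
      \<open>D\<close>.\<close>
    have "(x, y) \<in> S" if "x \<in> D" "y \<notin> D"
      using True that initial[of y x] S(4) unfolding total_on_def by metis
    then show ?thesis
      using True XY initial[of x y] outside[of x y] unfolding T_def by auto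
  qed (use S(1) in blast)
  then have "Restr T X = S" by auto
  ultimately show ?thesis using linT by blast
qed

theorem lemmaA4:
  fixes X :: "nat \<Rightarrow> 'a set" and R :: "nat \<Rightarrow> 'a rel"
  assumes "\<And>i. X i \<subseteq> X (Suc i)"
    and "\<And>i. countable (X i)"
    and "\<And>i. linear_order_of (X i) (R i)"
    and "\<And>i. order_type_omega (X i) (R i)"
    and "\<And>i. almost_agree (X i) (Restr (R (Suc i)) (X i)) (R i)"
  shows "\<exists>S :: nat \<Rightarrow> 'a rel.
           (\<forall>i. linear_order_of (X i) (S i) \<and> order_type_omega (X i) (S i)) \<and>
           S 0 = R 0 \<and>
           (\<forall>i. almost_agree (X i) (S i) (R i) \<and> Restr (S (Suc i)) (X i) = S i)"
proof -
  \<comment> \<open>The last conjunct pins down the starting order, since dependent choice by itself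
    only provides some \<open>s\<close> with \<open>P 0 s\<close>.\<close>
  define P where "P i s \<longleftrightarrow> linear_order_of (X i) s \<and> order_type_omega (X i) s \<and>
    almost_agree (X i) s (R i) \<and> (i = 0 \<longrightarrow> s = R 0)" for i s
  have "\<exists>S. \<forall>i. P i (S i) \<and> Restr (S (Suc i)) (X i) = S i"
  proof (rule dependent_nat_choice)
    show "\<exists>s. P 0 s"
      using assms(3,4) almost_agree_refl unfolding P_def by blast
  next
    fix s i assume s: "P i s"
    \<comment> \<open>The two orders are compared through \<open>R i\<close>, which is why
      \<open>P\<close> records almost agreement with \<open>R i\<close>.\<close>
    then have "almost_agree (X i) (Restr (R (Suc i)) (X i)) s"
      using assms(5) almost_agree_sym almost_agree_trans unfolding P_def by blast
    then show "\<exists>t. P (Suc i) t \<and> Restr t (X i) = s"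
      using extend_order_type_omega[OF assms(1) _ _ assms(3,4)] s unfolding P_def by blast
  qed
  then show ?thesis unfolding P_def by blast
qed

end
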